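(* Let $\mathbf{C}$ be a monoidal category. Restriction is a monad graded over the subunits, when we do not identify monomorphisms representing the same subunit. More precisely, it is an $\mathbf{E}$-graded monad on $\mathbf{C}$, where $\mathbf{E}$ has as objects monomorphisms $s \colon S \rightarrowtail I$ in $\mathbf{C}$ with $s \otimes S$ an isomorphism, and as morphisms $f \colon s \to t$ those $f \colon S \to T$ in $\mathbf{C}$ with $s = t \circ f$.
   Context: Monoidal categories are taken to be braided throughout. $I$ is the tensor unit of $\mathbf{C}$, and an object name also denotes its identity morphism. A subunit in $\mathbf{C}$ is a subobject $s \colon S \rightarrowtail I$ (an equivalence class of monomorphisms, identified when they factor through each other) such that $s \otimes S \colon S \otimes S \to I \otimes S$ is an isomorphism. Restriction to $s$ is tensoring with $S$; as $s$ varies it is here the functor $\mathbf{E} \to [\mathbf{C},\mathbf{C}]$ sending $s \colon S \rightarrowtail I$ to $(-) \otimes S$ and $f$ to the natural transformation $\mathrm{id}_{(-)} \otimes f$. The tensor product on $\mathbf{E}$ is the one inherited from $\mathbf{C}$: $s$ and $t$ have tensor product $\lambda_I \circ (s \otimes t) \colon S \otimes T \to I$, where $\lambda_I \colon I \otimes I \to I$ is the unitor, and the unit is $\mathrm{id}_I$. For a category $\mathbf{C}$, $[\mathbf{C},\mathbf{C}]$ denotes the monoidal category of endofunctors of $\mathbf{C}$ with $F \otimes G = G \circ F$. For a monoidal category $(\mathbf{E},\otimes,1)$, an $\mathbf{E}$-graded monad on $\mathbf{C}$ is a lax monoidal functor $T \colon \mathbf{E} \to [\mathbf{C},\mathbf{C}]$.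 Concretely, it is a functor $T \colon \mathbf{E} \to [\mathbf{C},\mathbf{C}]$ together with a natural transformation $\eta \colon \mathrm{id}_{\mathbf{C}} \Rightarrow T(1)$ and natural transformations $\mu_{s,t} \colon T(t) \circ T(s) \to T(s \otimes t)$ for all $s,t$ in $\mathbf{E}$, satisfying the associativity and unit laws of a lax monoidal functor.
   Formalization: It is additionally assumed that for objects s, t of E the tensor product λ_I∘(s⊗t): S⊗T→I is again a monomorphism; without this E need not be closed under the inherited tensor product, so it would not be a monoidal category. *)

theory Defs
  imports Main "HOL-Library.FuncSet"
begin

text \<open>
  Categories are given by explicit sets of objects and arrows, so that functor categories and
  subcategories are again values of the same kind. \<open>Comp C g f\<close> is \<open>g\<close> after \<open>f\<close>. Values
  outside these sets, and compositions of non-composable arrows, carry no meaning.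
\<close>

record ('o, 'a) category =
  Obj :: "'o set"
  Arr :: "'a set"
  Dom :: "'a \<Rightarrow> 'o"
  Cod :: "'a \<Rightarrow> 'o"
  Ident :: "'o \<Rightarrow> 'a"
  Comp :: "'a \<Rightarrow> 'a \<Rightarrow> 'a"  (infixl "\<odot>\<index>" 70)

definition hom :: "('o, 'a, 'm) category_scheme \<Rightarrow> 'o \<Rightarrow> 'o \<Rightarrow> 'a set" where
  "hom C A B = {f \<in> Arr C. Dom C f = A \<and> Cod C f = B}"

locale category =
  fixes C :: "('o, 'a, 'm) category_scheme" (structure)
  assumes Dom_in_Obj: "f \<in> Arr C \<Longrightarrow> Dom C f \<in> Obj C"
    and Cod_in_Obj: "f \<in> Arr C \<Longrightarrow> Cod C f \<in> Obj C"
    and Ident_in_hom: "A \<in> Obj C \<Longrightarrow> Ident C A \<in> hom C A A"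
    and Comp_in_hom: "\<lbrakk>f \<in> hom C A B; g \<in> hom C B D\<rbrakk> \<Longrightarrow> g \<odot> f \<in> hom C A D"
    and Comp_Ident_left: "f \<in> hom C A B \<Longrightarrow> Ident C B \<odot> f = f"
    and Comp_Ident_right: "f \<in> hom C A B \<Longrightarrow> f \<odot> Ident C A = f"
    and Comp_assoc: "\<lbrakk>f \<in> hom C A B; g \<in> hom C B D; h \<in> hom C D E\<rbrakk>
          \<Longrightarrow> (h \<odot> g) \<odot> f = h \<odot> (g \<odot> f)"

definition iso :: "('o, 'a, 'm) category_scheme \<Rightarrow> 'a \<Rightarrow> bool" where
  "iso C f \<longleftrightarrow> f \<in> Arr C \<and>
     (\<exists>g \<in> hom C (Cod C f) (Dom C f).
        Comp C g f = Ident C (Dom C f) \<and> Comp C f g = Ident C (Cod C f))"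

definition inv_arr :: "('o, 'a, 'm) category_scheme \<Rightarrow> 'a \<Rightarrow> 'a" where
  "inv_arr C f = (THE g. g \<in> hom C (Cod C f) (Dom C f) \<and>
     Comp C g f = Ident C (Dom C f) \<and> Comp C f g = Ident C (Cod C f))"

definition monic :: "('o, 'a, 'm) category_scheme \<Rightarrow> 'a \<Rightarrow> bool" where
  "monic C f \<longleftrightarrow> f \<in> Arr C \<and>
     (\<forall>X \<in> Obj C. \<forall>g \<in> hom C X (Dom C f). \<forall>h \<in> hom C X (Dom C f).
        Comp C f g = Comp C f h \<longrightarrow> g = h)"

record ('o, 'a) monoidal_category = "('o, 'a) category" +
  Unit :: "'o"
  TObj :: "'o \<Rightarrow> 'o \<Rightarrow> 'o"  (infixl "\<boxtimes>\<index>" 75)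
  TArr :: "'a \<Rightarrow> 'a \<Rightarrow> 'a"  (infixl "\<otimes>\<index>" 75)
  Assoc :: "'o \<Rightarrow> 'o \<Rightarrow> 'o \<Rightarrow> 'a"
  LUnit :: "'o \<Rightarrow> 'a"
  RUnit :: "'o \<Rightarrow> 'a"

locale monoidal_category = category C
  for C :: "('o, 'a, 'm) monoidal_category_scheme" (structure) +
  assumes Unit_in_Obj: "Unit C \<in> Obj C"
    and TObj_in_Obj: "\<lbrakk>A \<in> Obj C; B \<in> Obj C\<rbrakk> \<Longrightarrow> A \<boxtimes> B \<in> Obj C"
    and TArr_in_hom: "\<lbrakk>f \<in> hom C A A'; g \<in> hom C B B'\<rbrakk>
          \<Longrightarrow> f \<otimes> g \<in> hom C (A \<boxtimes> B) (A' \<boxtimes> B')"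
    and TArr_Ident: "\<lbrakk>A \<in> Obj C; B \<in> Obj C\<rbrakk>
          \<Longrightarrow> Ident C A \<otimes> Ident C B = Ident C (A \<boxtimes> B)"
    and TArr_Comp: "\<lbrakk>f \<in> hom C A A'; f' \<in> hom C A' A''; g \<in> hom C B B'; g' \<in> hom C B' B''\<rbrakk>
          \<Longrightarrow> (f' \<odot> f) \<otimes> (g' \<odot> g) = (f' \<otimes> g') \<odot> (f \<otimes> g)"
    and Assoc_in_hom: "\<lbrakk>A \<in> Obj C; B \<in> Obj C; D \<in> Obj C\<rbrakk>
          \<Longrightarrow> Assoc C A B D \<in> hom C (A \<boxtimes> B \<boxtimes> D) (A \<boxtimes> (B \<boxtimes> D))"
    and Assoc_iso: "\<lbrakk>A \<in> Obj C; B \<in> Obj C; D \<in> Obj C\<rbrakk> \<Longrightarrow> iso C (Assoc C A B D)"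
    and Assoc_natural: "\<lbrakk>f \<in> hom C A A'; g \<in> hom C B B'; h \<in> hom C D D'\<rbrakk>
          \<Longrightarrow> Assoc C A' B' D' \<odot> (f \<otimes> g \<otimes> h) = (f \<otimes> (g \<otimes> h)) \<odot> Assoc C A B D"
    and LUnit_in_hom: "A \<in> Obj C \<Longrightarrow> LUnit C A \<in> hom C (Unit C \<boxtimes> A) A"
    and LUnit_iso: "A \<in> Obj C \<Longrightarrow> iso C (LUnit C A)"
    and LUnit_natural: "f \<in> hom C A B \<Longrightarrow> LUnit C B \<odot> (Ident C (Unit C) \<otimes> f) = f \<odot> LUnit C A"
    and RUnit_in_hom: "A \<in> Obj C \<Longrightarrow> RUnit C A \<in> hom C (A \<boxtimes> Unit C) A"
    and RUnit_iso: "A \<in> Obj C \<Longrightarrow> iso C (RUnit C A)"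
    and RUnit_natural: "f \<in> hom C A B \<Longrightarrow> RUnit C B \<odot> (f \<otimes> Ident C (Unit C)) = f \<odot> RUnit C A"
    and pentagon: "\<lbrakk>A \<in> Obj C; B \<in> Obj C; D \<in> Obj C; E \<in> Obj C\<rbrakk>
          \<Longrightarrow> Assoc C A B (D \<boxtimes> E) \<odot> Assoc C (A \<boxtimes> B) D E
            = (Ident C A \<otimes> Assoc C B D E) \<odot> Assoc C A (B \<boxtimes> D) E \<odot> (Assoc C A B D \<otimes> Ident C E)"
    and triangle: "\<lbrakk>A \<in> Obj C; B \<in> Obj C\<rbrakk>
          \<Longrightarrow> (Ident C A \<otimes> LUnit C B) \<odot> Assoc C A (Unit C) B = RUnit C A \<otimes> Ident C B"

record ('o, 'a) braided_monoidal_category = "('o, 'a) monoidal_category" +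
  Braid :: "'o \<Rightarrow> 'o \<Rightarrow> 'a"

locale braided_monoidal_category = monoidal_category C
  for C :: "('o, 'a, 'm) braided_monoidal_category_scheme" (structure) +
  assumes Braid_in_hom: "\<lbrakk>A \<in> Obj C; B \<in> Obj C\<rbrakk> \<Longrightarrow> Braid C A B \<in> hom C (A \<boxtimes> B) (B \<boxtimes> A)"
    and Braid_iso: "\<lbrakk>A \<in> Obj C; B \<in> Obj C\<rbrakk> \<Longrightarrow> iso C (Braid C A B)"
    and Braid_natural: "\<lbrakk>f \<in> hom C A A'; g \<in> hom C B B'\<rbrakk>
          \<Longrightarrow> Braid C A' B' \<odot> (f \<otimes> g) = (g \<otimes> f) \<odot> Braid C A B"
    and hexagon1: "\<lbrakk>A \<in> Obj C; B \<in> Obj C; D \<in> Obj C\<rbrakk>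
          \<Longrightarrow> Assoc C B D A \<odot> Braid C A (B \<boxtimes> D) \<odot> Assoc C A B D
            = (Ident C B \<otimes> Braid C A D) \<odot> Assoc C B A D \<odot> (Braid C A B \<otimes> Ident C D)"
    and hexagon2: "\<lbrakk>A \<in> Obj C; B \<in> Obj C; D \<in> Obj C\<rbrakk>
          \<Longrightarrow> inv_arr C (Assoc C D A B) \<odot> Braid C (A \<boxtimes> B) D \<odot> inv_arr C (Assoc C A B D)
            = (Braid C A D \<otimes> Ident C B) \<odot> inv_arr C (Assoc C A D B) \<odot> (Ident C A \<otimes> Braid C B D)"

record ('o, 'a, 'p, 'b) cat_functor =
  OMap :: "'o \<Rightarrow> 'p"
  AMap :: "'a \<Rightarrow> 'b"

locale is_functor = source: category C + target: category D
  for C :: "('o, 'a, 'm) category_scheme" and D :: "('p, 'b, 'n) category_scheme"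
    and F :: "('o, 'a, 'p, 'b) cat_functor" +
  assumes OMap_in_Obj: "A \<in> Obj C \<Longrightarrow> OMap F A \<in> Obj D"
    and AMap_in_hom: "f \<in> hom C A B \<Longrightarrow> AMap F f \<in> hom D (OMap F A) (OMap F B)"
    and AMap_Ident: "A \<in> Obj C \<Longrightarrow> AMap F (Ident C A) = Ident D (OMap F A)"
    and AMap_Comp: "\<lbrakk>f \<in> hom C A B; g \<in> hom C B E\<rbrakk>
          \<Longrightarrow> AMap F (Comp C g f) = Comp D (AMap F g) (AMap F f)"

record ('o, 'a, 'p, 'b) nat_trans =
  NDom :: "('o, 'a, 'p, 'b) cat_functor"
  NCod :: "('o, 'a, 'p, 'b) cat_functor"
  NComp :: "'o \<Rightarrow> 'b"

locale is_nat_trans =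
  fixes C :: "('o, 'a, 'm) category_scheme" and D :: "('p, 'b, 'n) category_scheme"
    and \<tau> :: "('o, 'a, 'p, 'b) nat_trans"
  assumes NDom_functor: "is_functor C D (NDom \<tau>)"
    and NCod_functor: "is_functor C D (NCod \<tau>)"
    and NComp_in_hom: "A \<in> Obj C \<Longrightarrow> NComp \<tau> A \<in> hom D (OMap (NDom \<tau>) A) (OMap (NCod \<tau>) A)"
    and naturality: "f \<in> hom C A B
          \<Longrightarrow> Comp D (NComp \<tau> B) (AMap (NDom \<tau>) f) = Comp D (AMap (NCod \<tau>) f) (NComp \<tau> A)"

text \<open>
  Functors and natural transformations that are equal on the objects and arrows of \<open>C\<close> have to be
  equal as objects and arrows of the functor category, so all maps are taken to be \<open>undefined\<close> outside \<open>C\<close>.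
\<close>

definition ext_functor :: "('o, 'a, 'm) category_scheme \<Rightarrow> ('o, 'a, 'p, 'b) cat_functor \<Rightarrow> bool" where
  "ext_functor C F \<longleftrightarrow> OMap F \<in> extensional (Obj C) \<and> AMap F \<in> extensional (Arr C)"

definition id_functor :: "('o, 'a, 'm) category_scheme \<Rightarrow> ('o, 'a, 'o, 'a) cat_functor" where
  "id_functor C = \<lparr>OMap = (\<lambda>A\<in>Obj C. A), AMap = (\<lambda>f\<in>Arr C. f)\<rparr>"

definition comp_functor ::
  "('o, 'a, 'm) category_scheme \<Rightarrow> ('p, 'b, 'q, 'c) cat_functor \<Rightarrow> ('o, 'a, 'p, 'b) cat_functor
     \<Rightarrow> ('o, 'a, 'q, 'c) cat_functor" where
  "comp_functor C G F =
     \<lparr>OMap = (\<lambda>A\<in>Obj C. OMap G (OMap F A)), AMap = (\<lambda>f\<in>Arr C. AMap G (AMap F f))\<rparr>"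

definition id_nat ::
  "('o, 'a, 'm) category_scheme \<Rightarrow> ('p, 'b, 'n) category_scheme \<Rightarrow> ('o, 'a, 'p, 'b) cat_functor
     \<Rightarrow> ('o, 'a, 'p, 'b) nat_trans" where
  "id_nat C D F = \<lparr>NDom = F, NCod = F, NComp = (\<lambda>A\<in>Obj C. Ident D (OMap F A))\<rparr>"

definition vcomp_nat ::
  "('o, 'a, 'm) category_scheme \<Rightarrow> ('p, 'b, 'n) category_scheme \<Rightarrow> ('o, 'a, 'p, 'b) nat_trans
     \<Rightarrow> ('o, 'a, 'p, 'b) nat_trans \<Rightarrow> ('o, 'a, 'p, 'b) nat_trans" where
  "vcomp_nat C D \<tau> \<sigma> =
     \<lparr>NDom = NDom \<sigma>, NCod = NCod \<tau>, NComp = (\<lambda>A\<in>Obj C. Comp D (NComp \<tau> A) (NComp \<sigma> A))\<rparr>"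

text \<open>Horizontal composite: for \<open>\<sigma> : F \<Rightarrow> F'\<close> and \<open>\<tau> : G \<Rightarrow> G'\<close> it goes from \<open>G \<circ> F\<close> to \<open>G' \<circ> F'\<close>.\<close>

definition hcomp_nat ::
  "('o, 'a, 'm) category_scheme \<Rightarrow> ('o, 'a, 'o, 'a) nat_trans \<Rightarrow> ('o, 'a, 'o, 'a) nat_trans
     \<Rightarrow> ('o, 'a, 'o, 'a) nat_trans" where
  "hcomp_nat C \<tau> \<sigma> =
     \<lparr>NDom = comp_functor C (NDom \<tau>) (NDom \<sigma>),
      NCod = comp_functor C (NCod \<tau>) (NCod \<sigma>),
      NComp = (\<lambda>A\<in>Obj C. Comp C (NComp \<tau> (OMap (NCod \<sigma>) A)) (AMap (NDom \<tau>) (NComp \<sigma> A)))\<rparr>"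

text \<open>The strict monoidal category \<open>[C, C]\<close>, with \<open>F \<otimes> G = G \<circ> F\<close>.\<close>

definition endofunctor_category ::
  "('o, 'a, 'm) category_scheme
     \<Rightarrow> (('o, 'a, 'o, 'a) cat_functor, ('o, 'a, 'o, 'a) nat_trans) monoidal_category" where
  "endofunctor_category C =
     \<lparr>Obj = {F. is_functor C C F \<and> ext_functor C F},
      Arr = {\<tau>. is_nat_trans C C \<tau> \<and> ext_functor C (NDom \<tau>) \<and> ext_functor C (NCod \<tau>) \<and>
               NComp \<tau> \<in> extensional (Obj C)},
      Dom = NDom,
      Cod = NCod,
      Ident = id_nat C C,
      Comp = vcomp_nat C C,
      Unit = id_functor C,
      TObj = (\<lambda>F G. comp_functor C G F),
      TArr = (\<lambda>\<sigma> \<tau>. hcomp_nat C \<tau> \<sigma>),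
      Assoc = (\<lambda>F G H. id_nat C C (comp_functor C H (comp_functor C G F))),
      LUnit = id_nat C C,
      RUnit = id_nat C C\<rparr>"

locale lax_monoidal_functor =
  source: monoidal_category E + target: monoidal_category D + is_functor E D T
  for E :: "('o, 'a, 'm) monoidal_category_scheme" and D :: "('p, 'b, 'n) monoidal_category_scheme"
    and T :: "('o, 'a, 'p, 'b) cat_functor" +
  fixes \<eta> :: 'b and \<mu> :: "'o \<Rightarrow> 'o \<Rightarrow> 'b"
  assumes unit_in_hom: "\<eta> \<in> hom D (Unit D) (OMap T (Unit E))"
    and mult_in_hom: "\<lbrakk>s \<in> Obj E; t \<in> Obj E\<rbrakk>
          \<Longrightarrow> \<mu> s t \<in> hom D (OMap T s \<boxtimes>\<^bsub>D\<^esub> OMap T t) (OMap T (s \<boxtimes>\<^bsub>E\<^esub> t))"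
    and mult_natural: "\<lbrakk>f \<in> hom E s s'; g \<in> hom E t t'\<rbrakk>
          \<Longrightarrow> \<mu> s' t' \<odot>\<^bsub>D\<^esub> (AMap T f \<otimes>\<^bsub>D\<^esub> AMap T g) = AMap T (f \<otimes>\<^bsub>E\<^esub> g) \<odot>\<^bsub>D\<^esub> \<mu> s t"
    and mult_assoc: "\<lbrakk>s \<in> Obj E; t \<in> Obj E; u \<in> Obj E\<rbrakk>
          \<Longrightarrow> AMap T (Assoc E s t u) \<odot>\<^bsub>D\<^esub> \<mu> (s \<boxtimes>\<^bsub>E\<^esub> t) u \<odot>\<^bsub>D\<^esub> (\<mu> s t \<otimes>\<^bsub>D\<^esub> Ident D (OMap T u))
            = \<mu> s (t \<boxtimes>\<^bsub>E\<^esub> u) \<odot>\<^bsub>D\<^esub> (Ident D (OMap T s) \<otimes>\<^bsub>D\<^esub> \<mu> t u)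
                \<odot>\<^bsub>D\<^esub> Assoc D (OMap T s) (OMap T t) (OMap T u)"
    and mult_unit_left: "s \<in> Obj E
          \<Longrightarrow> AMap T (LUnit E s) \<odot>\<^bsub>D\<^esub> \<mu> (Unit E) s \<odot>\<^bsub>D\<^esub> (\<eta> \<otimes>\<^bsub>D\<^esub> Ident D (OMap T s))
            = LUnit D (OMap T s)"
    and mult_unit_right: "s \<in> Obj E
          \<Longrightarrow> AMap T (RUnit E s) \<odot>\<^bsub>D\<^esub> \<mu> s (Unit E) \<odot>\<^bsub>D\<^esub> (Ident D (OMap T s) \<otimes>\<^bsub>D\<^esub> \<eta>)
            = RUnit D (OMap T s)"

definition graded_monad ::
  "('p, 'b, 'n) monoidal_category_scheme \<Rightarrow> ('o, 'a, 'm) category_scheme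
     \<Rightarrow> ('p, 'b, ('o, 'a, 'o, 'a) cat_functor, ('o, 'a, 'o, 'a) nat_trans) cat_functor
     \<Rightarrow> ('o, 'a, 'o, 'a) nat_trans \<Rightarrow> ('p \<Rightarrow> 'p \<Rightarrow> ('o, 'a, 'o, 'a) nat_trans) \<Rightarrow> bool" where
  "graded_monad E C T \<eta> \<mu> \<longleftrightarrow>
     category C \<and> lax_monoidal_functor E (endofunctor_category C) T \<eta> \<mu>"

text \<open>
  An object \<open>s : S \<rightarrow> I\<close> of \<open>E\<close> is represented by the arrow \<open>s\<close> alone, and a morphism
  \<open>f : s \<rightarrow> t\<close> by the triple \<open>(s, f, t)\<close>, since \<open>f\<close> does not determine its endpoints.
\<close>

definition mono_subunit :: "('o, 'a, 'm) monoidal_category_scheme \<Rightarrow> 'a \<Rightarrow> bool" where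
  "mono_subunit C s \<longleftrightarrow> s \<in> Arr C \<and> Cod C s = Unit C \<and> monic C s \<and>
     iso C (s \<otimes>\<^bsub>C\<^esub> Ident C (Dom C s))"

text \<open>
  Without a further condition on \<open>C\<close> this arrow need not be monic when \<open>s\<close> and \<open>t\<close> are, so
  \<open>subunit_category\<close> is closed under its tensor product only if that is assumed.
\<close>

definition subunit_tensor :: "('o, 'a, 'm) monoidal_category_scheme \<Rightarrow> 'a \<Rightarrow> 'a \<Rightarrow> 'a" where
  "subunit_tensor C s t = LUnit C (Unit C) \<odot>\<^bsub>C\<^esub> (s \<otimes>\<^bsub>C\<^esub> t)"

definition subunit_category ::
  "('o, 'a, 'm) monoidal_category_scheme \<Rightarrow> ('a, 'a \<times> 'a \<times> 'a) monoidal_category" where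
  "subunit_category C =
     \<lparr>Obj = {s. mono_subunit C s},
      Arr = {(s, f, t). mono_subunit C s \<and> mono_subunit C t \<and>
               f \<in> hom C (Dom C s) (Dom C t) \<and> s = t \<odot>\<^bsub>C\<^esub> f},
      Dom = (\<lambda>(s, f, t). s),
      Cod = (\<lambda>(s, f, t). t),
      Ident = (\<lambda>s. (s, Ident C (Dom C s), s)),
      Comp = (\<lambda>(t, g, u) (s, f, t'). (s, g \<odot>\<^bsub>C\<^esub> f, u)),
      Unit = Ident C (Unit C),
      TObj = subunit_tensor C,
      TArr = (\<lambda>(s, f, t) (s', f', t'). (subunit_tensor C s s', f \<otimes>\<^bsub>C\<^esub> f', subunit_tensor C t t')),
      Assoc = (\<lambda>s t u. (subunit_tensor C (subunit_tensor C s t) u,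
                         Assoc C (Dom C s) (Dom C t) (Dom C u),
                         subunit_tensor C s (subunit_tensor C t u))),
      LUnit = (\<lambda>s. (subunit_tensor C (Ident C (Unit C)) s, LUnit C (Dom C s), s)),
      RUnit = (\<lambda>s. (subunit_tensor C s (Ident C (Unit C)), RUnit C (Dom C s), s))\<rparr>"

definition restrict_to :: "('o, 'a, 'm) monoidal_category_scheme \<Rightarrow> 'a \<Rightarrow> ('o, 'a, 'o, 'a) cat_functor"
where
  "restrict_to C s =
     \<lparr>OMap = (\<lambda>A\<in>Obj C. A \<boxtimes>\<^bsub>C\<^esub> Dom C s),
      AMap = (\<lambda>f\<in>Arr C. f \<otimes>\<^bsub>C\<^esub> Ident C (Dom C s))\<rparr>"

definition restriction ::
  "('o, 'a, 'm) monoidal_category_scheme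
     \<Rightarrow> ('a, 'a \<times> 'a \<times> 'a, ('o, 'a, 'o, 'a) cat_functor, ('o, 'a, 'o, 'a) nat_trans) cat_functor"
where
  "restriction C =
     \<lparr>OMap = restrict_to C,
      AMap = (\<lambda>(s, f, t). \<lparr>NDom = restrict_to C s, NCod = restrict_to C t,
                NComp = (\<lambda>A\<in>Obj C. Ident C A \<otimes>\<^bsub>C\<^esub> f)\<rparr>)\<rparr>"

end

theory Submission
  imports Defs
begin

text \<open>
  Everything comes from the monoidal structure of the base category itself. Sending an object \<open>S\<close> to
  the functor \<open>(-) \<otimes> S\<close> is monoidal up to the associator: the unit of the graded monad is
  \<open>\<rho>\<^sub>A\<^sup>-\<^sup>1 : A \<rightarrow> A \<otimes> I\<close>, the multiplication is \<open>\<alpha> : (A \<otimes> S) \<otimes> T \<rightarrow> A \<otimes> (S \<otimes> T)\<close>, and the associativity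
  law is the pentagon. The left unit law is the triangle, and the right unit law is Kelly's identity
  \<open>(A \<otimes> \<rho>\<^sub>S) \<circ> \<alpha> = \<rho>\<close> at \<open>A \<otimes> S\<close> (lemma \<open>RUnit_TObj\<close>), a consequence of the axioms. These laws see only
  the underlying objects of the subunits, and this gives \<open>restriction_lax_monoidal_functor\<close>.

  What has to be shown about subunits is that they form a monoidal category. Their coherence laws
  hold because those of the base category do, but the structure maps must be morphisms over \<open>I\<close>.
  For the right unitor and the associator this rests on \<open>\<lambda>\<^sub>I = \<rho>\<^sub>I\<close>, again due to Kelly
  (lemma \<open>LUnit_Unit_eq_RUnit_Unit\<close>). The tensor product of two subunits must again be one. It is
  assumed to be monic; that \<open>(s \<otimes> t) \<otimes> (S \<otimes> T)\<close> is invertible follows from the braiding, which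
  exchanges the middle two factors and so identifies it, up to isomorphism of arrows, with
  \<open>(s \<otimes> S) \<otimes> (t \<otimes> T)\<close>, a tensor product of two isomorphisms (lemma \<open>mono_subunit_tensor\<close>).
\<close>

section \<open>Categories\<close>

context category
begin

text \<open>
  The axioms speak of arrows in a given hom-set, whose endpoints a rewrite rule would have to guess.
  Stated through \<open>Arr\<close>, \<open>Dom\<close> and \<open>Cod\<close>, their side conditions can be discharged by simplification.
\<close>

lemma in_hom_iff: "f \<in> hom C A B \<longleftrightarrow> f \<in> Arr C \<and> Dom C f = A \<and> Cod C f = B"
  by (auto simp: hom_def)

lemma Dom_Cod_Obj [simp]:
  assumes "f \<in> Arr C"
  shows "Dom C f \<in> Obj C" and "Cod C f \<in> Obj C"
  using assms by (auto intro: Dom_in_Obj Cod_in_Obj)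

lemma Ident_simps [simp]:
  assumes "A \<in> Obj C"
  shows "Ident C A \<in> Arr C" and "Dom C (Ident C A) = A" and "Cod C (Ident C A) = A"
  using Ident_in_hom[OF assms] by (auto simp: in_hom_iff)

lemma Comp_simps [simp]:
  assumes "f \<in> Arr C" and "g \<in> Arr C" and "Cod C f = Dom C g"
  shows "g \<odot> f \<in> Arr C" and "Dom C (g \<odot> f) = Dom C f" and "Cod C (g \<odot> f) = Cod C g"
  using Comp_in_hom[of f "Dom C f" "Cod C f" g "Cod C g"] assms by (auto simp: in_hom_iff)

lemma Comp_Ident_simps [simp]:
  assumes "f \<in> Arr C"
  shows "Cod C f = B \<Longrightarrow> Ident C B \<odot> f = f" and "Dom C f = A \<Longrightarrow> f \<odot> Ident C A = f"
  using assms Comp_Ident_left[of f] Comp_Ident_right[of f] by (auto simp: in_hom_iff)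

lemma Comp_assoc_Arr:
  assumes "f \<in> Arr C" and "g \<in> Arr C" and "h \<in> Arr C"
    and "Cod C f = Dom C g" and "Cod C g = Dom C h"
  shows "(h \<odot> g) \<odot> f = h \<odot> (g \<odot> f)"
  using assms by (intro Comp_assoc) (auto simp: in_hom_iff)

lemma isoI:
  assumes "f \<in> Arr C" and "g \<in> Arr C" and "Dom C g = Cod C f" and "Cod C g = Dom C f"
    and "g \<odot> f = Ident C (Dom C f)" and "f \<odot> g = Ident C (Cod C f)"
  shows "iso C f"
  using assms by (auto simp: iso_def in_hom_iff)

lemma inverse_unique:
  assumes "f \<in> Arr C"
    and "g \<in> hom C (Cod C f) (Dom C f)" and "g \<odot> f = Ident C (Dom C f)"
    and "h \<in> hom C (Cod C f) (Dom C f)" and "f \<odot> h = Ident C (Cod C f)"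
  shows "g = h"
proof -
  have "g = g \<odot> (f \<odot> h)"
    using assms by (simp add: in_hom_iff)
  also have "\<dots> = (g \<odot> f) \<odot> h"
    using assms(1,2,4) by (intro Comp_assoc_Arr[symmetric]) (auto simp: in_hom_iff)
  also have "\<dots> = h"
    using assms by (simp add: in_hom_iff)
  finally show ?thesis .
qed

lemma iso_Arr: "iso C f \<Longrightarrow> f \<in> Arr C"
  by (simp add: iso_def)

lemma inv_arr_simps [simp]:
  assumes "iso C f"
  shows "inv_arr C f \<in> Arr C"
    and "Dom C (inv_arr C f) = Cod C f" and "Cod C (inv_arr C f) = Dom C f"
    and "inv_arr C f \<odot> f = Ident C (Dom C f)" and "f \<odot> inv_arr C f = Ident C (Cod C f)"
proof -
  let ?P = "\<lambda>g. g \<in> hom C (Cod C f) (Dom C f) \<and>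
    g \<odot> f = Ident C (Dom C f) \<and> f \<odot> g = Ident C (Cod C f)"
  obtain g where g: "?P g"
    using assms by (auto simp: iso_def)
  have "?P (inv_arr C f)"
    unfolding inv_arr_def
    using g by (rule theI) (use assms g in \<open>auto simp: iso_def intro: inverse_unique\<close>)
  then show "inv_arr C f \<in> Arr C"
    and "Dom C (inv_arr C f) = Cod C f" and "Cod C (inv_arr C f) = Dom C f"
    and "inv_arr C f \<odot> f = Ident C (Dom C f)" and "f \<odot> inv_arr C f = Ident C (Cod C f)"
    by (auto simp: in_hom_iff)
qed

lemma iso_inv_arr: "iso C f \<Longrightarrow> iso C (inv_arr C f)"
  by (rule isoI[of _ f]) (auto dest: iso_Arr)

lemma iso_Ident: "A \<in> Obj C \<Longrightarrow> iso C (Ident C A)"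
  by (rule isoI[of _ "Ident C A"]) auto

lemma inv_arr_Comp_Comp:
  assumes "iso C g" and "f \<in> Arr C" and "Cod C f = Dom C g"
  shows "inv_arr C g \<odot> (g \<odot> f) = f"
  using assms by (simp add: iso_Arr flip: Comp_assoc_Arr)

lemma Comp_inv_arr_Comp:
  assumes "iso C g" and "f \<in> Arr C" and "Cod C f = Cod C g"
  shows "g \<odot> (inv_arr C g \<odot> f) = f"
  using assms by (simp add: iso_Arr flip: Comp_assoc_Arr)

lemma iso_Comp:
  assumes "iso C f" and "iso C g" and "Cod C f = Dom C g"
  shows "iso C (g \<odot> f)"
proof (rule isoI)
  show "inv_arr C f \<odot> inv_arr C g \<odot> (g \<odot> f) = Ident C (Dom C (g \<odot> f))"
    using assms by (simp add: iso_Arr Comp_assoc_Arr inv_arr_Comp_Comp)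
  show "g \<odot> f \<odot> (inv_arr C f \<odot> inv_arr C g) = Ident C (Cod C (g \<odot> f))"
    using assms by (simp add: iso_Arr Comp_assoc_Arr Comp_inv_arr_Comp)
qed (use assms in \<open>auto simp: iso_Arr\<close>)

lemma iso_cancel_left:
  assumes "iso C g" and "f \<in> Arr C" and "h \<in> Arr C" and "Cod C f = Dom C g" and "Cod C h = Dom C g"
    and "g \<odot> f = g \<odot> h"
  shows "f = h"
  using assms inv_arr_Comp_Comp by metis

lemma iso_cancel_right:
  assumes "iso C g" and "f \<in> Arr C" and "h \<in> Arr C" and "Dom C f = Cod C g" and "Dom C h = Cod C g"
    and "f \<odot> g = h \<odot> g"
  shows "f = h"
proof -
  have "f = f \<odot> g \<odot> inv_arr C g"
    using assms(1-5) by (simp add: Comp_assoc_Arr iso_Arr)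
  also have "\<dots> = h \<odot> g \<odot> inv_arr C g"
    by (simp add: assms(6))
  also have "\<dots> = h"
    using assms(1-5) by (simp add: Comp_assoc_Arr iso_Arr)
  finally show ?thesis .
qed

lemma monic_Ident: "A \<in> Obj C \<Longrightarrow> monic C (Ident C A)"
  by (auto simp: monic_def in_hom_iff)

text \<open>
  Isomorphism in the arrow category. Naturality squares of invertible transformations are
  instances, and being invertible is invariant under it.
\<close>

definition arrows_isomorphic :: "'a \<Rightarrow> 'a \<Rightarrow> bool" where
  "arrows_isomorphic f g \<longleftrightarrow> f \<in> Arr C \<and> g \<in> Arr C \<and>
     (\<exists>a b. iso C a \<and> iso C b \<and> Dom C a = Dom C f \<and> Cod C a = Dom C g \<and>
        Dom C b = Cod C f \<and> Cod C b = Cod C g \<and> b \<odot> f = g \<odot> a)"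

lemma arrows_isomorphicI:
  assumes "f \<in> Arr C" and "g \<in> Arr C" and "iso C a" and "iso C b"
    and "Dom C a = Dom C f" and "Cod C a = Dom C g"
    and "Dom C b = Cod C f" and "Cod C b = Cod C g" and "b \<odot> f = g \<odot> a"
  shows "arrows_isomorphic f g"
  using assms unfolding arrows_isomorphic_def by blast

lemma arrows_isomorphicE:
  assumes "arrows_isomorphic f g"
  obtains a b where "f \<in> Arr C" and "g \<in> Arr C" and "iso C a" and "iso C b"
    and "Dom C a = Dom C f" and "Cod C a = Dom C g"
    and "Dom C b = Cod C f" and "Cod C b = Cod C g" and "b \<odot> f = g \<odot> a"
  using assms unfolding arrows_isomorphic_def by blast

lemma arrows_isomorphic_refl: "f \<in> Arr C \<Longrightarrow> arrows_isomorphic f f"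
  by (rule arrows_isomorphicI[of _ _ "Ident C (Dom C f)" "Ident C (Cod C f)"])
    (auto simp: iso_Ident)

lemma arrows_isomorphic_sym:
  assumes "arrows_isomorphic f g"
  shows "arrows_isomorphic g f"
proof -
  from assms obtain a b where ab: "f \<in> Arr C" "g \<in> Arr C" "iso C a" "iso C b"
    "Dom C a = Dom C f" "Cod C a = Dom C g" "Dom C b = Cod C f" "Cod C b = Cod C g"
    and square: "b \<odot> f = g \<odot> a"
    by (rule arrows_isomorphicE)
  have "inv_arr C b \<odot> g = inv_arr C b \<odot> (g \<odot> a) \<odot> inv_arr C a"
    using ab by (simp add: Comp_assoc_Arr iso_Arr)
  also have "\<dots> = inv_arr C b \<odot> (b \<odot> f) \<odot> inv_arr C a"
    by (simp add: square)
  also have "\<dots> = f \<odot> inv_arr C a"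
    using ab by (simp add: inv_arr_Comp_Comp)
  finally show ?thesis
    using ab by (intro arrows_isomorphicI[of _ _ "inv_arr C a" "inv_arr C b"]) (auto simp: iso_inv_arr)
qed

lemma arrows_isomorphic_trans [trans]:
  assumes "arrows_isomorphic f g" and "arrows_isomorphic g h"
  shows "arrows_isomorphic f h"
proof -
  from assms(1) obtain a b where ab: "f \<in> Arr C" "g \<in> Arr C" "iso C a" "iso C b"
    "Dom C a = Dom C f" "Cod C a = Dom C g" "Dom C b = Cod C f" "Cod C b = Cod C g"
    and square: "b \<odot> f = g \<odot> a"
    by (rule arrows_isomorphicE)
  from assms(2) obtain a' b' where ab': "h \<in> Arr C" "iso C a'" "iso C b'"
    "Dom C a' = Dom C g" "Cod C a' = Dom C h" "Dom C b' = Cod C g" "Cod C b' = Cod C h"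
    and square': "b' \<odot> g = h \<odot> a'"
    by (rule arrows_isomorphicE)
  have "b' \<odot> b \<odot> f = b' \<odot> g \<odot> a"
    using ab ab' square by (simp add: Comp_assoc_Arr iso_Arr)
  also have "\<dots> = h \<odot> (a' \<odot> a)"
    using ab ab' square' by (simp add: Comp_assoc_Arr iso_Arr)
  finally show ?thesis
    using ab ab'
    by (intro arrows_isomorphicI[of _ _ "a' \<odot> a" "b' \<odot> b"]) (auto simp: iso_Arr iso_Comp)
qed

lemma arrows_isomorphic_iso:
  assumes "arrows_isomorphic f g" and "iso C g"
  shows "iso C f"
proof -
  from assms(1) obtain a b where ab: "f \<in> Arr C" "g \<in> Arr C" "iso C a" "iso C b"
    "Dom C a = Dom C f" "Cod C a = Dom C g" "Dom C b = Cod C f" "Cod C b = Cod C g"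
    and square: "b \<odot> f = g \<odot> a"
    by (rule arrows_isomorphicE)
  have "f = inv_arr C b \<odot> (g \<odot> a)"
    using ab by (simp add: inv_arr_Comp_Comp flip: square)
  also have "iso C \<dots>"
    using ab assms(2) by (intro iso_Comp iso_inv_arr) (auto simp: iso_Arr)
  finally show ?thesis .
qed

end

section \<open>Monoidal categories\<close>

context monoidal_category
begin

lemma Unit_Obj [simp]: "Unit C \<in> Obj C"
  by (rule Unit_in_Obj)

lemma TObj_Obj [simp]: "A \<in> Obj C \<Longrightarrow> B \<in> Obj C \<Longrightarrow> A \<boxtimes> B \<in> Obj C"
  by (rule TObj_in_Obj)

lemma TArr_simps [simp]:
  assumes "f \<in> Arr C" and "g \<in> Arr C"
  shows "f \<otimes> g \<in> Arr C" and "Dom C (f \<otimes> g) = Dom C f \<boxtimes> Dom C g"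
    and "Cod C (f \<otimes> g) = Cod C f \<boxtimes> Cod C g"
  using TArr_in_hom[of f "Dom C f" "Cod C f" g "Dom C g" "Cod C g"] assms
  by (auto simp: in_hom_iff)

declare TArr_Ident [simp]

lemma Assoc_simps [simp]:
  assumes "A \<in> Obj C" and "B \<in> Obj C" and "D \<in> Obj C"
  shows "Assoc C A B D \<in> Arr C" and "Dom C (Assoc C A B D) = A \<boxtimes> B \<boxtimes> D"
    and "Cod C (Assoc C A B D) = A \<boxtimes> (B \<boxtimes> D)" and "iso C (Assoc C A B D)"
  using Assoc_in_hom[OF assms] Assoc_iso[OF assms] by (auto simp: in_hom_iff)

lemma LUnit_simps [simp]:
  assumes "A \<in> Obj C"
  shows "LUnit C A \<in> Arr C" and "Dom C (LUnit C A) = Unit C \<boxtimes> A"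
    and "Cod C (LUnit C A) = A" and "iso C (LUnit C A)"
  using LUnit_in_hom[OF assms] LUnit_iso[OF assms] by (auto simp: in_hom_iff)

lemma RUnit_simps [simp]:
  assumes "A \<in> Obj C"
  shows "RUnit C A \<in> Arr C" and "Dom C (RUnit C A) = A \<boxtimes> Unit C"
    and "Cod C (RUnit C A) = A" and "iso C (RUnit C A)"
  using RUnit_in_hom[OF assms] RUnit_iso[OF assms] by (auto simp: in_hom_iff)

lemma interchange:
  assumes "f \<in> Arr C" and "f' \<in> Arr C" and "Cod C f = Dom C f'"
    and "g \<in> Arr C" and "g' \<in> Arr C" and "Cod C g = Dom C g'"
  shows "(f' \<otimes> g') \<odot> (f \<otimes> g) = (f' \<odot> f) \<otimes> (g' \<odot> g)"
  using TArr_Comp[of f _ _ f' _ g _ _ g'] assms by (simp add: in_hom_iff)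

lemma Assoc_natural_Arr:
  assumes "f \<in> Arr C" and "g \<in> Arr C" and "h \<in> Arr C"
  shows "Assoc C (Cod C f) (Cod C g) (Cod C h) \<odot> (f \<otimes> g \<otimes> h)
    = (f \<otimes> (g \<otimes> h)) \<odot> Assoc C (Dom C f) (Dom C g) (Dom C h)"
  using assms by (intro Assoc_natural) (auto simp: in_hom_iff)

lemma LUnit_natural_Arr:
  assumes "f \<in> Arr C"
  shows "LUnit C (Cod C f) \<odot> (Ident C (Unit C) \<otimes> f) = f \<odot> LUnit C (Dom C f)"
  using assms by (intro LUnit_natural) (auto simp: in_hom_iff)

lemma RUnit_natural_Arr:
  assumes "f \<in> Arr C"
  shows "RUnit C (Cod C f) \<odot> (f \<otimes> Ident C (Unit C)) = f \<odot> RUnit C (Dom C f)"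
  using assms by (intro RUnit_natural) (auto simp: in_hom_iff)

lemma iso_TArr:
  assumes "iso C f" and "iso C g"
  shows "iso C (f \<otimes> g)"
  using assms by (intro isoI[of _ "inv_arr C f \<otimes> inv_arr C g"]) (auto simp: iso_Arr interchange)

lemma arrows_isomorphic_TArr:
  assumes "arrows_isomorphic f g" and "arrows_isomorphic f' g'"
  shows "arrows_isomorphic (f \<otimes> f') (g \<otimes> g')"
proof -
  from assms(1) obtain a b where ab: "f \<in> Arr C" "g \<in> Arr C" "iso C a" "iso C b"
    "Dom C a = Dom C f" "Cod C a = Dom C g" "Dom C b = Cod C f" "Cod C b = Cod C g"
    "b \<odot> f = g \<odot> a"
    by (rule arrows_isomorphicE)
  from assms(2) obtain a' b' where ab': "f' \<in> Arr C" "g' \<in> Arr C" "iso C a'" "iso C b'"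
    "Dom C a' = Dom C f'" "Cod C a' = Dom C g'" "Dom C b' = Cod C f'" "Cod C b' = Cod C g'"
    "b' \<odot> f' = g' \<odot> a'"
    by (rule arrows_isomorphicE)
  show ?thesis
    by (rule arrows_isomorphicI[of _ _ "a \<otimes> a'" "b \<otimes> b'"])
      (use ab ab' in \<open>simp_all add: iso_Arr iso_TArr interchange\<close>)
qed

lemma arrows_isomorphic_Assoc:
  assumes "f \<in> Arr C" and "g \<in> Arr C" and "h \<in> Arr C"
  shows "arrows_isomorphic (f \<otimes> g \<otimes> h) (f \<otimes> (g \<otimes> h))"
  using assms Assoc_natural_Arr[OF assms]
  by (intro arrows_isomorphicI[of _ _ "Assoc C (Dom C f) (Dom C g) (Dom C h)"
        "Assoc C (Cod C f) (Cod C g) (Cod C h)"]) auto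

lemma TArr_Unit_right_cancel:
  assumes "f \<in> Arr C" and "g \<in> Arr C" and "Dom C f = Dom C g" and "Cod C f = Cod C g"
    and "f \<otimes> Ident C (Unit C) = g \<otimes> Ident C (Unit C)"
  shows "f = g"
proof (rule iso_cancel_right)
  show "f \<odot> RUnit C (Dom C f) = g \<odot> RUnit C (Dom C f)"
    using assms by (metis RUnit_natural_Arr)
qed (use assms in auto)

lemma TArr_Unit_left_cancel:
  assumes "f \<in> Arr C" and "g \<in> Arr C" and "Dom C f = Dom C g" and "Cod C f = Cod C g"
    and "Ident C (Unit C) \<otimes> f = Ident C (Unit C) \<otimes> g"
  shows "f = g"
proof (rule iso_cancel_right)
  show "f \<odot> LUnit C (Dom C f) = g \<odot> LUnit C (Dom C f)"
    using assms by (metis LUnit_natural_Arr)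
qed (use assms in auto)

text \<open>
  Kelly's argument. Both sides may be compared after applying \<open>(-) \<otimes> I\<close>, which is faithful because
  \<open>\<rho>\<close> is natural and invertible, and after composing with the isomorphism \<open>\<alpha>\<^bsub>A,B,I\<^esub>\<close>. There the pentagon
  for \<open>A, B, I, I\<close> and two triangles turn one side into the other.
\<close>

lemma RUnit_TObj:
  assumes [simp]: "A \<in> Obj C" "B \<in> Obj C"
  shows "(Ident C A \<otimes> RUnit C B) \<odot> Assoc C A B (Unit C) = RUnit C (A \<boxtimes> B)"
proof -
  let ?I = "Unit C"
  have "Assoc C A B ?I \<odot> (RUnit C (A \<boxtimes> B) \<otimes> Ident C ?I)
      = Assoc C A B ?I \<odot> ((Ident C (A \<boxtimes> B) \<otimes> LUnit C ?I) \<odot> Assoc C (A \<boxtimes> B) ?I ?I)"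
    by (simp add: triangle)
  also have "\<dots> = Assoc C A B ?I \<odot> (Ident C A \<otimes> Ident C B \<otimes> LUnit C ?I) \<odot> Assoc C (A \<boxtimes> B) ?I ?I"
    by (simp add: Comp_assoc_Arr)
  also have "\<dots> = (Ident C A \<otimes> (Ident C B \<otimes> LUnit C ?I))
      \<odot> (Assoc C A B (?I \<boxtimes> ?I) \<odot> Assoc C (A \<boxtimes> B) ?I ?I)"
    using Assoc_natural_Arr[of "Ident C A" "Ident C B" "LUnit C ?I"]
    by (simp add: Comp_assoc_Arr del: TArr_Ident)
  also have "\<dots> = ((Ident C A \<otimes> (Ident C B \<otimes> LUnit C ?I)) \<odot> (Ident C A \<otimes> Assoc C B ?I ?I))
      \<odot> Assoc C A (B \<boxtimes> ?I) ?I \<odot> (Assoc C A B ?I \<otimes> Ident C ?I)"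
    by (simp add: pentagon Comp_assoc_Arr)
  also have "\<dots> = (Ident C A \<otimes> (RUnit C B \<otimes> Ident C ?I))
      \<odot> Assoc C A (B \<boxtimes> ?I) ?I \<odot> (Assoc C A B ?I \<otimes> Ident C ?I)"
    by (simp add: interchange triangle)
  also have "\<dots> = Assoc C A B ?I \<odot> (Ident C A \<otimes> RUnit C B \<otimes> Ident C ?I)
      \<odot> (Assoc C A B ?I \<otimes> Ident C ?I)"
    using Assoc_natural_Arr[of "Ident C A" "RUnit C B" "Ident C ?I"] by simp
  also have "\<dots> = Assoc C A B ?I \<odot> (((Ident C A \<otimes> RUnit C B) \<odot> Assoc C A B ?I) \<otimes> Ident C ?I)"
    by (simp add: Comp_assoc_Arr interchange)
  finally have "RUnit C (A \<boxtimes> B) \<otimes> Ident C ?I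
      = ((Ident C A \<otimes> RUnit C B) \<odot> Assoc C A B ?I) \<otimes> Ident C ?I"
    by - (rule iso_cancel_left[of "Assoc C A B ?I"], simp_all)
  then show ?thesis
    by - (rule TArr_Unit_right_cancel, simp_all)
qed

text \<open>
  Naturality of \<open>\<rho>\<close> at the arrow \<open>\<rho>\<^sub>I\<close> gives \<open>\<rho>\<^sub>I \<otimes> I = \<rho>\<close> at \<open>I \<otimes> I\<close>. The left side is \<open>(I \<otimes> \<lambda>\<^sub>I) \<circ> \<alpha>\<close> by
  the triangle and the right side is \<open>(I \<otimes> \<rho>\<^sub>I) \<circ> \<alpha>\<close>, so \<open>I \<otimes> \<lambda>\<^sub>I = I \<otimes> \<rho>\<^sub>I\<close>.
\<close>

lemma LUnit_Unit_eq_RUnit_Unit: "LUnit C (Unit C) = RUnit C (Unit C)"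
proof -
  let ?I = "Unit C"
  have "RUnit C ?I \<odot> (RUnit C ?I \<otimes> Ident C ?I) = RUnit C ?I \<odot> RUnit C (?I \<boxtimes> ?I)"
    using RUnit_natural_Arr[of "RUnit C ?I"] by simp
  then have "RUnit C ?I \<otimes> Ident C ?I = RUnit C (?I \<boxtimes> ?I)"
    by - (rule iso_cancel_left[of "RUnit C ?I"], simp_all)
  then have "(Ident C ?I \<otimes> LUnit C ?I) \<odot> Assoc C ?I ?I ?I
      = (Ident C ?I \<otimes> RUnit C ?I) \<odot> Assoc C ?I ?I ?I"
    by (simp add: triangle RUnit_TObj)
  then have "Ident C ?I \<otimes> LUnit C ?I = Ident C ?I \<otimes> RUnit C ?I"
    by - (rule iso_cancel_right[of "Assoc C ?I ?I ?I"], simp_all)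
  then show ?thesis
    by - (rule TArr_Unit_left_cancel, simp_all)
qed

end

section \<open>Braided monoidal categories\<close>

lemma (in braided_monoidal_category) Braid_simps [simp]:
  assumes "A \<in> Obj C" and "B \<in> Obj C"
  shows "Braid C A B \<in> Arr C" and "Dom C (Braid C A B) = A \<boxtimes> B"
    and "Cod C (Braid C A B) = B \<boxtimes> A" and "iso C (Braid C A B)"
  using Braid_in_hom[OF assms] Braid_iso[OF assms] by (auto simp: in_hom_iff)

lemma (in braided_monoidal_category) arrows_isomorphic_Braid:
  assumes "f \<in> Arr C" and "g \<in> Arr C"
  shows "arrows_isomorphic (f \<otimes> g) (g \<otimes> f)"
  using assms Braid_natural[of f "Dom C f" "Cod C f" g "Dom C g" "Cod C g"]
  by (intro arrows_isomorphicI[of _ _ "Braid C (Dom C f) (Dom C g)" "Braid C (Cod C f) (Cod C g)"])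
    (auto simp: in_hom_iff)

text \<open>
  Rebracketing, braiding and rebracketing back exchanges the middle two factors naturally in all four
  arguments. Working up to isomorphism of arrows, the composite never has to be written down.
\<close>

lemma (in braided_monoidal_category) arrows_isomorphic_middle_four:
  assumes f: "f \<in> Arr C" and g: "g \<in> Arr C" and h: "h \<in> Arr C" and k: "k \<in> Arr C"
  shows "arrows_isomorphic (f \<otimes> g \<otimes> (h \<otimes> k)) (f \<otimes> h \<otimes> (g \<otimes> k))"
proof -
  have "arrows_isomorphic (g \<otimes> (h \<otimes> k)) (g \<otimes> h \<otimes> k)"
    using assms by (intro arrows_isomorphic_sym[OF arrows_isomorphic_Assoc])
  also have "arrows_isomorphic (g \<otimes> h \<otimes> k) (h \<otimes> g \<otimes> k)"
    using assms by (intro arrows_isomorphic_TArr arrows_isomorphic_Braid arrows_isomorphic_refl)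
  also have "arrows_isomorphic (h \<otimes> g \<otimes> k) (h \<otimes> (g \<otimes> k))"
    using assms by (intro arrows_isomorphic_Assoc)
  finally have swap: "arrows_isomorphic (g \<otimes> (h \<otimes> k)) (h \<otimes> (g \<otimes> k))" .
  have "arrows_isomorphic (f \<otimes> g \<otimes> (h \<otimes> k)) (f \<otimes> (g \<otimes> (h \<otimes> k)))"
    using assms by (intro arrows_isomorphic_Assoc) auto
  also have "arrows_isomorphic (f \<otimes> (g \<otimes> (h \<otimes> k))) (f \<otimes> (h \<otimes> (g \<otimes> k)))"
    by (rule arrows_isomorphic_TArr[OF arrows_isomorphic_refl[OF f] swap])
  also have "arrows_isomorphic (f \<otimes> (h \<otimes> (g \<otimes> k))) (f \<otimes> h \<otimes> (g \<otimes> k))"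
    using assms by (intro arrows_isomorphic_sym[OF arrows_isomorphic_Assoc]) auto
  finally show ?thesis .
qed

section \<open>The monoidal category of subunits\<close>

lemma (in monoidal_category) mono_subunit_Unit [simp]: "mono_subunit C (Ident C (Unit C))"
  by (simp add: mono_subunit_def monic_Ident iso_Ident)

lemma (in monoidal_category) mono_subunit_simps [simp]:
  assumes "mono_subunit C s"
  shows "s \<in> Arr C" and "Cod C s = Unit C"
  using assms unfolding mono_subunit_def by blast+

lemma (in monoidal_category) mono_subunit_iso:
  assumes "mono_subunit C s"
  shows "iso C (s \<otimes> Ident C (Dom C s))"
  using assms unfolding mono_subunit_def by blast

lemma (in monoidal_category) subunit_tensor_simps [simp]:
  assumes "mono_subunit C s" and "mono_subunit C t"
  shows "subunit_tensor C s t \<in> Arr C"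
    and "Dom C (subunit_tensor C s t) = Dom C s \<boxtimes> Dom C t"
    and "Cod C (subunit_tensor C s t) = Unit C"
  using assms by (auto simp: subunit_tensor_def)

lemma (in monoidal_category) subunit_tensor_Comp:
  assumes "mono_subunit C s" and "mono_subunit C t" and "f \<in> Arr C" and "g \<in> Arr C"
    and "Cod C f = Dom C s" and "Cod C g = Dom C t"
  shows "subunit_tensor C (s \<odot> f) (t \<odot> g) = subunit_tensor C s t \<odot> (f \<otimes> g)"
  using assms by (simp add: subunit_tensor_def Comp_assoc_Arr interchange)

text \<open>
  The two composites \<open>(I \<otimes> I) \<otimes> I \<rightarrow> I\<close> built from unitors agree: one begins with \<open>\<lambda>\<^sub>I \<otimes> I\<close>,
  which is \<open>\<rho>\<^sub>I \<otimes> I\<close>, and the triangle rewrites this to \<open>(I \<otimes> \<lambda>\<^sub>I) \<circ> \<alpha>\<close>.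
\<close>

lemma (in monoidal_category) subunit_tensor_Assoc:
  assumes "mono_subunit C s" and "mono_subunit C t" and "mono_subunit C u"
  shows "subunit_tensor C (subunit_tensor C s t) u
    = subunit_tensor C s (subunit_tensor C t u) \<odot> Assoc C (Dom C s) (Dom C t) (Dom C u)"
proof -
  let ?I = "Unit C"
  have "subunit_tensor C (subunit_tensor C s t) u
      = LUnit C ?I \<odot> ((RUnit C ?I \<otimes> Ident C ?I) \<odot> (s \<otimes> t \<otimes> u))"
    using assms by (simp add: subunit_tensor_def interchange LUnit_Unit_eq_RUnit_Unit)
  also have "\<dots> = LUnit C ?I \<odot> ((Ident C ?I \<otimes> LUnit C ?I) \<odot> (Assoc C ?I ?I ?I \<odot> (s \<otimes> t \<otimes> u)))"
    using assms by (simp add: Comp_assoc_Arr flip: triangle)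
  also have "\<dots> = LUnit C ?I \<odot> ((Ident C ?I \<otimes> LUnit C ?I)
      \<odot> ((s \<otimes> (t \<otimes> u)) \<odot> Assoc C (Dom C s) (Dom C t) (Dom C u)))"
    using assms Assoc_natural_Arr[of s t u] by simp
  also have "\<dots> = LUnit C ?I \<odot> ((Ident C ?I \<otimes> LUnit C ?I) \<odot> (s \<otimes> (t \<otimes> u)))
      \<odot> Assoc C (Dom C s) (Dom C t) (Dom C u)"
    using assms by (simp add: Comp_assoc_Arr)
  also have "\<dots> = subunit_tensor C s (subunit_tensor C t u) \<odot> Assoc C (Dom C s) (Dom C t) (Dom C u)"
    using assms by (simp add: subunit_tensor_def interchange)
  finally show ?thesis .
qed

lemma (in monoidal_category) subunit_tensor_LUnit:
  assumes "mono_subunit C s"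
  shows "subunit_tensor C (Ident C (Unit C)) s = s \<odot> LUnit C (Dom C s)"
  using LUnit_natural_Arr[of s] assms by (simp add: subunit_tensor_def)

lemma (in monoidal_category) subunit_tensor_RUnit:
  assumes "mono_subunit C s"
  shows "subunit_tensor C s (Ident C (Unit C)) = s \<odot> RUnit C (Dom C s)"
  using RUnit_natural_Arr[of s] assms by (simp add: subunit_tensor_def LUnit_Unit_eq_RUnit_Unit)

text \<open>
  The arrow \<open>\<lambda>\<^sub>I \<circ> (s \<otimes> t)\<close> differs from \<open>s \<otimes> t\<close> by an isomorphism, and exchanging the middle factors
  of \<open>(s \<otimes> t) \<otimes> (S \<otimes> T)\<close> gives the tensor product of the isomorphisms \<open>s \<otimes> S\<close> and \<open>t \<otimes> T\<close>.
\<close>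

lemma (in braided_monoidal_category) mono_subunit_tensor:
  assumes s: "mono_subunit C s" and t: "mono_subunit C t"
    and "monic C (subunit_tensor C s t)"
  shows "mono_subunit C (subunit_tensor C s t)"
proof -
  let ?S = "Ident C (Dom C s)" and ?T = "Ident C (Dom C t)" and ?I = "Unit C"
  have "iso C (s \<otimes> ?S \<otimes> (t \<otimes> ?T))"
    using s t by (simp add: iso_TArr mono_subunit_iso)
  then have "iso C (s \<otimes> t \<otimes> (?S \<otimes> ?T))"
    using s t by - (rule arrows_isomorphic_iso[OF arrows_isomorphic_middle_four], simp_all)
  then have "iso C ((LUnit C ?I \<otimes> (?S \<otimes> ?T)) \<odot> (s \<otimes> t \<otimes> (?S \<otimes> ?T)))"
    using s t by (simp add: iso_Comp iso_TArr iso_Ident)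
  then have "iso C (subunit_tensor C s t \<otimes> Ident C (Dom C (subunit_tensor C s t)))"
    \<comment> \<open>The domain has to be computed before the tensor product of subunits is unfolded.\<close>
    using s t by (simp add: interchange) (simp add: subunit_tensor_def)
  then show ?thesis
    unfolding mono_subunit_def[of C "subunit_tensor C s t"] using assms by simp
qed

lemma subunit_category_simps [simp]:
  "s \<in> Obj (subunit_category C) \<longleftrightarrow> mono_subunit C s"
  "Dom (subunit_category C) (s, f, t) = s"
  "Cod (subunit_category C) (s, f, t) = t"
  "Ident (subunit_category C) s = (s, Ident C (Dom C s), s)"
  "Comp (subunit_category C) (t, g, u) (s, f, t') = (s, g \<odot>\<^bsub>C\<^esub> f, u)"
  "Unit (subunit_category C) = Ident C (Unit C)"
  "TObj (subunit_category C) = subunit_tensor C"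
  "TArr (subunit_category C) (s, f, t) (s', f', t')
     = (subunit_tensor C s s', f \<otimes>\<^bsub>C\<^esub> f', subunit_tensor C t t')"
  "Assoc (subunit_category C) s t u = (subunit_tensor C (subunit_tensor C s t) u,
     Assoc C (Dom C s) (Dom C t) (Dom C u), subunit_tensor C s (subunit_tensor C t u))"
  "LUnit (subunit_category C) s = (subunit_tensor C (Ident C (Unit C)) s, LUnit C (Dom C s), s)"
  "RUnit (subunit_category C) s = (subunit_tensor C s (Ident C (Unit C)), RUnit C (Dom C s), s)"
  by (simp_all add: subunit_category_def)

text \<open>
  The condition on \<open>Dom C f\<close> is implied by \<open>s = t \<circ> f\<close>. Leaving it out avoids the circular equation
  \<open>Dom C f = Dom C (t \<circ> f)\<close> that appears once \<open>s\<close> is replaced by \<open>t \<circ> f\<close>.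
\<close>

lemma (in monoidal_category) subunit_Arr_iff:
  "(s, f, t) \<in> Arr (subunit_category C) \<longleftrightarrow> mono_subunit C s \<and> mono_subunit C t \<and>
     f \<in> Arr C \<and> Cod C f = Dom C t \<and> s = t \<odot> f"
  by (auto simp: subunit_category_def hom_def)

lemma (in monoidal_category) subunit_hom_iff:
  "x \<in> hom (subunit_category C) s t \<longleftrightarrow> (\<exists>f. x = (s, f, t) \<and> mono_subunit C s \<and>
     mono_subunit C t \<and> f \<in> Arr C \<and> Cod C f = Dom C t \<and> s = t \<odot> f)"
  by (cases x) (auto simp: hom_def subunit_Arr_iff)

lemma (in monoidal_category) category_subunit: "category (subunit_category C)"
proof
  show "Dom (subunit_category C) f \<in> Obj (subunit_category C)"
    and "Cod (subunit_category C) f \<in> Obj (subunit_category C)"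
    if "f \<in> Arr (subunit_category C)" for f
    using that by (cases f; simp add: subunit_Arr_iff)+
qed (auto simp: subunit_hom_iff Comp_assoc_Arr)

text \<open>
  The inverse of \<open>f\<close> in the base category lies over \<open>I\<close> as well, because \<open>t = t \<circ> f \<circ> f\<^sup>-\<^sup>1 = s \<circ> f\<^sup>-\<^sup>1\<close>.
\<close>

lemma (in monoidal_category) subunit_iso:
  assumes s: "mono_subunit C s" and t: "mono_subunit C t"
    and f: "iso C f" "Cod C f = Dom C t" "s = t \<odot> f"
  shows "iso (subunit_category C) (s, f, t)"
proof -
  have "t = s \<odot> inv_arr C f" and Dom_s: "Dom C s = Dom C f"
    using t f by (simp_all add: Comp_assoc_Arr iso_Arr)
  then have "(t, inv_arr C f, s) \<in> hom (subunit_category C) t s"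
    using s t f(1,2) unfolding subunit_hom_iff by auto
  moreover have "(s, f, t) \<in> Arr (subunit_category C)"
    using s t f unfolding subunit_Arr_iff by (auto simp: iso_Arr)
  ultimately show ?thesis
    unfolding iso_def[of "subunit_category C"]
    using f(1,2) Dom_s by (auto intro!: bexI[of _ "(t, inv_arr C f, s)"])
qed

lemma (in braided_monoidal_category) monoidal_category_subunit:
  assumes "\<And>s t. mono_subunit C s \<Longrightarrow> mono_subunit C t \<Longrightarrow> monic C (subunit_tensor C s t)"
  shows "monoidal_category (subunit_category C)"
proof -
  interpret E: category "subunit_category C"
    by (rule category_subunit)
  have tensor [simp]: "mono_subunit C (subunit_tensor C s t)"
    if "mono_subunit C s" "mono_subunit C t" for s t
    using that assms by (intro mono_subunit_tensor)
  show ?thesis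
  proof (unfold_locales, goal_cases Unit TObj TArr TArr_Ident TArr_Comp Assoc Assoc_iso Assoc_natural
      LUnit LUnit_iso LUnit_natural RUnit RUnit_iso RUnit_natural pentagon triangle)
    case (TArr f s s' g t t')
    then show ?case
      by (auto simp: subunit_hom_iff simp flip: subunit_tensor_Comp)
  next
    case (TArr_Comp f s s' s'' g t t' t'')
    then show ?case
      by (auto simp: subunit_hom_iff interchange)
  next
    case (Assoc s t u)
    then show ?case
      by (simp add: subunit_hom_iff flip: subunit_tensor_Assoc)
  next
    case (Assoc_iso s t u)
    then show ?case
      by (simp add: subunit_iso flip: subunit_tensor_Assoc)
  next
    case (Assoc_natural f s s' g t t' h u u')
    then show ?case
      by (auto simp: subunit_hom_iff simp flip: Assoc_natural_Arr)
  next
    case (LUnit s)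
    then show ?case
      by (simp add: subunit_hom_iff flip: subunit_tensor_LUnit)
  next
    case (LUnit_iso s)
    then show ?case
      by (simp add: subunit_iso flip: subunit_tensor_LUnit)
  next
    case (LUnit_natural f s t)
    then show ?case
      using LUnit_natural_Arr by (fastforce simp: subunit_hom_iff)
  next
    case (RUnit s)
    then show ?case
      by (simp add: subunit_hom_iff flip: subunit_tensor_RUnit)
  next
    case (RUnit_iso s)
    then show ?case
      by (simp add: subunit_iso flip: subunit_tensor_RUnit)
  next
    case (RUnit_natural f s t)
    then show ?case
      using RUnit_natural_Arr by (fastforce simp: subunit_hom_iff)
  qed (simp_all add: pentagon triangle)
qed

section \<open>The monoidal category of endofunctors\<close>

lemma endofunctor_category_simps [simp]:
  "Dom (endofunctor_category C) = NDom"
  "Cod (endofunctor_category C) = NCod"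
  "Ident (endofunctor_category C) = id_nat C C"
  "Comp (endofunctor_category C) = vcomp_nat C C"
  "Unit (endofunctor_category C) = id_functor C"
  "TObj (endofunctor_category C) F G = comp_functor C G F"
  "TArr (endofunctor_category C) \<sigma> \<tau> = hcomp_nat C \<tau> \<sigma>"
  "Assoc (endofunctor_category C) F G H
     = id_nat C C (comp_functor C H (comp_functor C G F))"
  "LUnit (endofunctor_category C) = id_nat C C"
  "RUnit (endofunctor_category C) = id_nat C C"
  by (simp_all add: endofunctor_category_def)

context category
begin

abbreviation Endo where "Endo \<equiv> endofunctor_category C"

lemma endofunctor_simps [simp]:
  assumes "F \<in> Obj Endo"
  shows "A \<in> Obj C \<Longrightarrow> OMap F A \<in> Obj C"
    and "f \<in> Arr C \<Longrightarrow> AMap F f \<in> Arr C"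
    and "f \<in> Arr C \<Longrightarrow> Dom C (AMap F f) = OMap F (Dom C f)"
    and "f \<in> Arr C \<Longrightarrow> Cod C (AMap F f) = OMap F (Cod C f)"
    and "A \<in> Obj C \<Longrightarrow> AMap F (Ident C A) = Ident C (OMap F A)"
    and "f \<in> Arr C \<Longrightarrow> g \<in> Arr C \<Longrightarrow> Cod C f = Dom C g \<Longrightarrow> AMap F (g \<odot> f) = AMap F g \<odot> AMap F f"
proof -
  interpret F: is_functor C C F
    using assms by (simp add: endofunctor_category_def)
  show "A \<in> Obj C \<Longrightarrow> OMap F A \<in> Obj C"
    and "A \<in> Obj C \<Longrightarrow> AMap F (Ident C A) = Ident C (OMap F A)"
    by (auto intro: F.OMap_in_Obj F.AMap_Ident)
  show "f \<in> Arr C \<Longrightarrow> AMap F f \<in> Arr C"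
    and "f \<in> Arr C \<Longrightarrow> Dom C (AMap F f) = OMap F (Dom C f)"
    and "f \<in> Arr C \<Longrightarrow> Cod C (AMap F f) = OMap F (Cod C f)"
    using F.AMap_in_hom[of f "Dom C f" "Cod C f"] by (auto simp: in_hom_iff)
  show "f \<in> Arr C \<Longrightarrow> g \<in> Arr C \<Longrightarrow> Cod C f = Dom C g \<Longrightarrow> AMap F (g \<odot> f) = AMap F g \<odot> AMap F f"
    by (rule F.AMap_Comp) (auto simp: in_hom_iff)
qed

lemma endofunctorI:
  assumes "\<And>A. A \<in> Obj C \<Longrightarrow> OMap F A \<in> Obj C"
    and "\<And>f. f \<in> Arr C \<Longrightarrow> AMap F f \<in> Arr C"
    and "\<And>f. f \<in> Arr C \<Longrightarrow> Dom C (AMap F f) = OMap F (Dom C f)"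
    and "\<And>f. f \<in> Arr C \<Longrightarrow> Cod C (AMap F f) = OMap F (Cod C f)"
    and "\<And>A. A \<in> Obj C \<Longrightarrow> AMap F (Ident C A) = Ident C (OMap F A)"
    and "\<And>f g. f \<in> Arr C \<Longrightarrow> g \<in> Arr C \<Longrightarrow> Cod C f = Dom C g
      \<Longrightarrow> AMap F (g \<odot> f) = AMap F g \<odot> AMap F f"
    and "ext_functor C F"
  shows "F \<in> Obj Endo"
proof -
  have "is_functor C C F"
    by unfold_locales (use assms in \<open>auto simp: in_hom_iff\<close>)
  then show ?thesis
    using assms(7) by (simp add: endofunctor_category_def)
qed

text \<open>
  Agreement on the category suffices for equality because all maps are \<open>undefined\<close> elsewhere. This
  is what makes composition of endofunctors strictly associative and unital.
\<close>

lemma endofunctor_eqI: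
  assumes "F \<in> Obj Endo" and "G \<in> Obj Endo"
    and "\<And>A. A \<in> Obj C \<Longrightarrow> OMap F A = OMap G A" and "\<And>f. f \<in> Arr C \<Longrightarrow> AMap F f = AMap G f"
  shows "F = G"
proof (rule cat_functor.equality)
  show "OMap F = OMap G" and "AMap F = AMap G"
    using assms unfolding endofunctor_category_def ext_functor_def
    by (auto intro: extensionalityI)
qed simp

lemma id_functor_simps [simp]:
  shows "id_functor C \<in> Obj Endo"
    and "A \<in> Obj C \<Longrightarrow> OMap (id_functor C) A = A"
    and "f \<in> Arr C \<Longrightarrow> AMap (id_functor C) f = f"
  by (auto intro!: endofunctorI simp: id_functor_def ext_functor_def)

lemma comp_functor_simps [simp]:
  shows "A \<in> Obj C \<Longrightarrow> OMap (comp_functor C G F) A = OMap G (OMap F A)"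
    and "f \<in> Arr C \<Longrightarrow> AMap (comp_functor C G F) f = AMap G (AMap F f)"
    and "F \<in> Obj Endo \<Longrightarrow> G \<in> Obj Endo \<Longrightarrow> comp_functor C G F \<in> Obj Endo"
  by (auto intro!: endofunctorI simp: comp_functor_def ext_functor_def)

lemma comp_functor_id [simp]:
  assumes "F \<in> Obj Endo"
  shows "comp_functor C F (id_functor C) = F" and "comp_functor C (id_functor C) F = F"
  using assms by (auto intro: endofunctor_eqI)

lemma comp_functor_assoc:
  assumes "F \<in> Obj Endo" and "G \<in> Obj Endo" and "H \<in> Obj Endo"
  shows "comp_functor C (comp_functor C H G) F = comp_functor C H (comp_functor C G F)"
  using assms by (auto intro: endofunctor_eqI)

lemma endo_nat_simps [simp]:
  assumes "\<tau> \<in> Arr Endo"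
  shows "NDom \<tau> \<in> Obj Endo" and "NCod \<tau> \<in> Obj Endo"
    and "A \<in> Obj C \<Longrightarrow> NComp \<tau> A \<in> Arr C"
    and "A \<in> Obj C \<Longrightarrow> Dom C (NComp \<tau> A) = OMap (NDom \<tau>) A"
    and "A \<in> Obj C \<Longrightarrow> Cod C (NComp \<tau> A) = OMap (NCod \<tau>) A"
proof -
  interpret \<tau>: is_nat_trans C C \<tau>
    using assms by (simp add: endofunctor_category_def)
  show "NDom \<tau> \<in> Obj Endo" and "NCod \<tau> \<in> Obj Endo"
    using assms \<tau>.NDom_functor \<tau>.NCod_functor by (auto simp: endofunctor_category_def)
  show "A \<in> Obj C \<Longrightarrow> NComp \<tau> A \<in> Arr C"
    and "A \<in> Obj C \<Longrightarrow> Dom C (NComp \<tau> A) = OMap (NDom \<tau>) A"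
    and "A \<in> Obj C \<Longrightarrow> Cod C (NComp \<tau> A) = OMap (NCod \<tau>) A"
    using \<tau>.NComp_in_hom by (auto simp: in_hom_iff)
qed

lemma endo_nat_naturality:
  assumes "\<tau> \<in> Arr Endo" and "f \<in> Arr C"
  shows "NComp \<tau> (Cod C f) \<odot> AMap (NDom \<tau>) f = AMap (NCod \<tau>) f \<odot> NComp \<tau> (Dom C f)"
proof -
  interpret \<tau>: is_nat_trans C C \<tau>
    using assms by (simp add: endofunctor_category_def)
  show ?thesis
    using assms by (intro \<tau>.naturality) (simp add: in_hom_iff)
qed

lemma endo_natI:
  assumes "NDom \<tau> \<in> Obj Endo" and "NCod \<tau> \<in> Obj Endo" and "NComp \<tau> \<in> extensional (Obj C)"
    and "\<And>A. A \<in> Obj C \<Longrightarrow> NComp \<tau> A \<in> Arr C"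
    and "\<And>A. A \<in> Obj C \<Longrightarrow> Dom C (NComp \<tau> A) = OMap (NDom \<tau>) A"
    and "\<And>A. A \<in> Obj C \<Longrightarrow> Cod C (NComp \<tau> A) = OMap (NCod \<tau>) A"
    and "\<And>f. f \<in> Arr C
      \<Longrightarrow> NComp \<tau> (Cod C f) \<odot> AMap (NDom \<tau>) f = AMap (NCod \<tau>) f \<odot> NComp \<tau> (Dom C f)"
  shows "\<tau> \<in> Arr Endo"
proof -
  have "is_nat_trans C C \<tau>"
    by unfold_locales (use assms in \<open>auto simp: in_hom_iff endofunctor_category_def\<close>)
  then show ?thesis
    using assms(1-3) by (simp add: endofunctor_category_def)
qed

lemma endo_nat_eqI:
  assumes "\<sigma> \<in> Arr Endo" and "\<tau> \<in> Arr Endo" and "NDom \<sigma> = NDom \<tau>" and "NCod \<sigma> = NCod \<tau>"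
    and "\<And>A. A \<in> Obj C \<Longrightarrow> NComp \<sigma> A = NComp \<tau> A"
  shows "\<sigma> = \<tau>"
proof (rule nat_trans.equality)
  show "NComp \<sigma> = NComp \<tau>"
    using assms(1,2,5) unfolding endofunctor_category_def by (auto intro: extensionalityI)
qed (use assms in simp_all)

lemma id_nat_simps [simp]:
  shows "NDom (id_nat C C F) = F" and "NCod (id_nat C C F) = F"
    and "A \<in> Obj C \<Longrightarrow> NComp (id_nat C C F) A = Ident C (OMap F A)"
    and "F \<in> Obj Endo \<Longrightarrow> id_nat C C F \<in> Arr Endo"
  by (auto intro!: endo_natI simp: id_nat_def)

lemma vcomp_nat_simps [simp]:
  shows "NDom (vcomp_nat C C \<tau> \<sigma>) = NDom \<sigma>" and "NCod (vcomp_nat C C \<tau> \<sigma>) = NCod \<tau>"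
    and "A \<in> Obj C \<Longrightarrow> NComp (vcomp_nat C C \<tau> \<sigma>) A = NComp \<tau> A \<odot> NComp \<sigma> A"
  by (auto simp: vcomp_nat_def)

lemma vcomp_nat_Arr [simp]:
  assumes "\<sigma> \<in> Arr Endo" and "\<tau> \<in> Arr Endo" and "NCod \<sigma> = NDom \<tau>"
  shows "vcomp_nat C C \<tau> \<sigma> \<in> Arr Endo"
proof (rule endo_natI)
  fix f assume f: "f \<in> Arr C"
  have "NComp \<tau> (Cod C f) \<odot> NComp \<sigma> (Cod C f) \<odot> AMap (NDom \<sigma>) f
      = NComp \<tau> (Cod C f) \<odot> AMap (NCod \<sigma>) f \<odot> NComp \<sigma> (Dom C f)"
    using assms f by (simp add: Comp_assoc_Arr endo_nat_naturality[OF assms(1) f])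
  also have "\<dots> = AMap (NCod \<tau>) f \<odot> (NComp \<tau> (Dom C f) \<odot> NComp \<sigma> (Dom C f))"
    using assms f by (simp add: endo_nat_naturality flip: Comp_assoc_Arr)
  finally show "NComp (vcomp_nat C C \<tau> \<sigma>) (Cod C f) \<odot> AMap (NDom (vcomp_nat C C \<tau> \<sigma>)) f
      = AMap (NCod (vcomp_nat C C \<tau> \<sigma>)) f \<odot> NComp (vcomp_nat C C \<tau> \<sigma>) (Dom C f)"
    using f by simp
qed (use assms in \<open>simp_all, simp add: vcomp_nat_def\<close>)

lemma hcomp_nat_simps [simp]:
  shows "NDom (hcomp_nat C \<tau> \<sigma>) = comp_functor C (NDom \<tau>) (NDom \<sigma>)"
    and "NCod (hcomp_nat C \<tau> \<sigma>) = comp_functor C (NCod \<tau>) (NCod \<sigma>)"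
    and "A \<in> Obj C \<Longrightarrow> NComp (hcomp_nat C \<tau> \<sigma>) A
      = NComp \<tau> (OMap (NCod \<sigma>) A) \<odot> AMap (NDom \<tau>) (NComp \<sigma> A)"
  by (auto simp: hcomp_nat_def)

lemma hcomp_nat_Arr [simp]:
  assumes "\<sigma> \<in> Arr Endo" and "\<tau> \<in> Arr Endo"
  shows "hcomp_nat C \<tau> \<sigma> \<in> Arr Endo"
proof (rule endo_natI)
  fix f assume f: "f \<in> Arr C"
  let ?A = "Dom C f" and ?B = "Cod C f"
  have "NComp \<tau> (OMap (NCod \<sigma>) ?B) \<odot> AMap (NDom \<tau>) (NComp \<sigma> ?B) \<odot> AMap (NDom \<tau>) (AMap (NDom \<sigma>) f)
      = NComp \<tau> (OMap (NCod \<sigma>) ?B) \<odot> AMap (NDom \<tau>) (NComp \<sigma> ?B \<odot> AMap (NDom \<sigma>) f)"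
    using assms f by (simp add: Comp_assoc_Arr)
  also have "\<dots> = NComp \<tau> (OMap (NCod \<sigma>) ?B) \<odot> AMap (NDom \<tau>) (AMap (NCod \<sigma>) f)
      \<odot> AMap (NDom \<tau>) (NComp \<sigma> ?A)"
    using assms f by (simp only: endo_nat_naturality) (simp add: Comp_assoc_Arr)
  also have "\<dots> = AMap (NCod \<tau>) (AMap (NCod \<sigma>) f) \<odot> NComp \<tau> (OMap (NCod \<sigma>) ?A)
      \<odot> AMap (NDom \<tau>) (NComp \<sigma> ?A)"
    using assms f endo_nat_naturality[of \<tau> "AMap (NCod \<sigma>) f"] by simp
  finally show "NComp (hcomp_nat C \<tau> \<sigma>) ?B \<odot> AMap (NDom (hcomp_nat C \<tau> \<sigma>)) f
      = AMap (NCod (hcomp_nat C \<tau> \<sigma>)) f \<odot> NComp (hcomp_nat C \<tau> \<sigma>) ?A"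
    using assms f by (simp add: Comp_assoc_Arr)
qed (use assms in \<open>simp_all, simp add: hcomp_nat_def\<close>)

lemma category_Endo: "category Endo"
proof
  show "Dom Endo \<tau> \<in> Obj Endo" and "Cod Endo \<tau> \<in> Obj Endo" if "\<tau> \<in> Arr Endo" for \<tau>
    using that by auto
qed (auto simp: hom_def Comp_assoc_Arr intro!: endo_nat_eqI)

text \<open>
  At \<open>A\<close> the two sides apply \<open>\<tau>\<close> and \<open>\<sigma>'\<close> in opposite orders; naturality of \<open>\<tau>\<close> at the component
  \<open>\<sigma>'\<^sub>A\<close> exchanges them.
\<close>

lemma hcomp_vcomp_interchange:
  assumes "\<sigma> \<in> Arr Endo" and "\<sigma>' \<in> Arr Endo" and "NCod \<sigma> = NDom \<sigma>'"
    and "\<tau> \<in> Arr Endo" and "\<tau>' \<in> Arr Endo" and "NCod \<tau> = NDom \<tau>'"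
  shows "hcomp_nat C (vcomp_nat C C \<tau>' \<tau>) (vcomp_nat C C \<sigma>' \<sigma>)
    = vcomp_nat C C (hcomp_nat C \<tau>' \<sigma>') (hcomp_nat C \<tau> \<sigma>)"
proof (rule endo_nat_eqI)
  fix A assume A: "A \<in> Obj C"
  let ?B = "OMap (NCod \<sigma>') A" and ?B' = "OMap (NDom \<sigma>') A"
  have "NComp \<tau>' ?B \<odot> NComp \<tau> ?B \<odot> AMap (NDom \<tau>) (NComp \<sigma>' A \<odot> NComp \<sigma> A)
      = NComp \<tau>' ?B \<odot> ((NComp \<tau> ?B \<odot> AMap (NDom \<tau>) (NComp \<sigma>' A)) \<odot> AMap (NDom \<tau>) (NComp \<sigma> A))"
    using assms A by (simp add: Comp_assoc_Arr)
  also have "NComp \<tau> ?B \<odot> AMap (NDom \<tau>) (NComp \<sigma>' A) = AMap (NDom \<tau>') (NComp \<sigma>' A) \<odot> NComp \<tau> ?B'"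
    using assms A endo_nat_naturality[of \<tau> "NComp \<sigma>' A"] by simp
  finally show "NComp (hcomp_nat C (vcomp_nat C C \<tau>' \<tau>) (vcomp_nat C C \<sigma>' \<sigma>)) A
      = NComp (vcomp_nat C C (hcomp_nat C \<tau>' \<sigma>') (hcomp_nat C \<tau> \<sigma>)) A"
    using assms A by (simp add: Comp_assoc_Arr)
qed (use assms in simp_all)

lemma monoidal_category_Endo: "monoidal_category Endo"
proof -
  interpret Endo: category Endo
    by (rule category_Endo)
  have iso_id [simp]: "iso Endo (id_nat C C F)" if "F \<in> Obj Endo" for F
    using Endo.iso_Ident[OF that] by simp
  show ?thesis
  proof (unfold_locales, goal_cases Unit TObj TArr TArr_Ident TArr_Comp Assoc Assoc_iso Assoc_natural
      LUnit LUnit_iso LUnit_natural RUnit RUnit_iso RUnit_natural pentagon triangle)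
    case (TArr_Comp \<sigma> F F' \<sigma>' F'' \<tau> G G' \<tau>' G'')
    then show ?case
      by (simp add: Endo.in_hom_iff hcomp_vcomp_interchange)
  qed (auto simp: Endo.in_hom_iff comp_functor_assoc Comp_assoc_Arr intro!: endo_nat_eqI)
qed

end

section \<open>Restriction as a lax monoidal functor\<close>

lemma restriction_simps [simp]:
  "OMap (restriction C) = restrict_to C"
  "NDom (AMap (restriction C) (s, f, t)) = restrict_to C s"
  "NCod (AMap (restriction C) (s, f, t)) = restrict_to C t"
  "A \<in> Obj C \<Longrightarrow> NComp (AMap (restriction C) (s, f, t)) A = Ident C A \<otimes>\<^bsub>C\<^esub> f"
  by (simp_all add: restriction_def)

context monoidal_category
begin

lemma restrict_to_simps [simp]:
  assumes "s \<in> Arr C"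
  shows "A \<in> Obj C \<Longrightarrow> OMap (restrict_to C s) A = A \<boxtimes> Dom C s"
    and "f \<in> Arr C \<Longrightarrow> AMap (restrict_to C s) f = f \<otimes> Ident C (Dom C s)"
    and "restrict_to C s \<in> Obj Endo"
  using assms by (auto intro!: endofunctorI simp: restrict_to_def ext_functor_def interchange)

definition restriction_unit :: "('o, 'a, 'o, 'a) nat_trans" where
  "restriction_unit = \<lparr>NDom = id_functor C, NCod = restrict_to C (Ident C (Unit C)),
     NComp = (\<lambda>A\<in>Obj C. inv_arr C (RUnit C A))\<rparr>"

definition restriction_mult :: "'a \<Rightarrow> 'a \<Rightarrow> ('o, 'a, 'o, 'a) nat_trans" where
  "restriction_mult s t = \<lparr>NDom = comp_functor C (restrict_to C t) (restrict_to C s),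
     NCod = restrict_to C (subunit_tensor C s t),
     NComp = (\<lambda>A\<in>Obj C. Assoc C A (Dom C s) (Dom C t))\<rparr>"

lemma restriction_unit_simps [simp]:
  shows "NDom restriction_unit = id_functor C"
    and "NCod restriction_unit = restrict_to C (Ident C (Unit C))"
    and "A \<in> Obj C \<Longrightarrow> NComp restriction_unit A = inv_arr C (RUnit C A)"
  by (simp_all add: restriction_unit_def)

lemma restriction_mult_simps [simp]:
  shows "NDom (restriction_mult s t) = comp_functor C (restrict_to C t) (restrict_to C s)"
    and "NCod (restriction_mult s t) = restrict_to C (subunit_tensor C s t)"
    and "A \<in> Obj C \<Longrightarrow> NComp (restriction_mult s t) A = Assoc C A (Dom C s) (Dom C t)"
  by (simp_all add: restriction_mult_def)

lemma restriction_unit_Arr [simp]: "restriction_unit \<in> Arr Endo"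
proof (rule endo_natI)
  fix f assume f: "f \<in> Arr C"
  let ?A = "Dom C f" and ?B = "Cod C f"
  have "inv_arr C (RUnit C ?B) \<odot> f = inv_arr C (RUnit C ?B) \<odot> (f \<odot> RUnit C ?A) \<odot> inv_arr C (RUnit C ?A)"
    using f by (simp add: Comp_assoc_Arr)
  also have "\<dots> = (f \<otimes> Ident C (Unit C)) \<odot> inv_arr C (RUnit C ?A)"
    using f by (simp add: inv_arr_Comp_Comp flip: RUnit_natural_Arr)
  finally show "NComp restriction_unit ?B \<odot> AMap (NDom restriction_unit) f
      = AMap (NCod restriction_unit) f \<odot> NComp restriction_unit ?A"
    using f by simp
qed (simp_all, simp add: restriction_unit_def)

lemma restriction_mult_Arr [simp]:
  assumes "mono_subunit C s" and "mono_subunit C t"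
  shows "restriction_mult s t \<in> Arr Endo"
proof (rule endo_natI)
  fix f assume f: "f \<in> Arr C"
  show "NComp (restriction_mult s t) (Cod C f) \<odot> AMap (NDom (restriction_mult s t)) f
      = AMap (NCod (restriction_mult s t)) f \<odot> NComp (restriction_mult s t) (Dom C f)"
    using assms f Assoc_natural_Arr[of f "Ident C (Dom C s)" "Ident C (Dom C t)"] by simp
qed (use assms in \<open>simp_all, simp add: restriction_mult_def\<close>)

lemma restriction_AMap_Arr [simp]:
  assumes "s \<in> Arr C" and "t \<in> Arr C" and "f \<in> Arr C" and "Dom C f = Dom C s" and "Cod C f = Dom C t"
  shows "AMap (restriction C) (s, f, t) \<in> Arr Endo"
  by (rule endo_natI) (use assms in \<open>simp_all add: interchange\<close>, simp add: restriction_def)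

lemma restriction_functor: "is_functor (subunit_category C) Endo (restriction C)"
proof -
  interpret E: category "subunit_category C"
    by (rule category_subunit)
  interpret Endo: category Endo
    by (rule category_Endo)
  show ?thesis
  proof (unfold_locales, goal_cases OMap AMap Ident Comp)
    case (AMap f s t)
    then show ?case
      by (auto simp: subunit_hom_iff Endo.in_hom_iff)
  next
    case (Ident s)
    then show ?case
      by (auto intro!: endo_nat_eqI)
  next
    case (Comp f s t g u)
    then show ?case
      by (auto simp: subunit_hom_iff interchange intro!: endo_nat_eqI)
  qed simp
qed

text \<open>
  Evaluated at \<open>A\<close>, the associativity law is the pentagon for \<open>A, S, T, U\<close>, and the left unit law is
  the triangle for \<open>A, S\<close> composed with \<open>\<rho>\<^sub>A\<^sup>-\<^sup>1 \<otimes> S\<close>. The right unit law contains the inverse of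
  \<open>\<rho>\<close> at \<open>A \<otimes> S\<close>, which Kelly's identity cancels.
\<close>

lemma restriction_lax_monoidal_functor:
  assumes "monoidal_category (subunit_category C)"
  shows "lax_monoidal_functor (subunit_category C) Endo (restriction C)
    restriction_unit restriction_mult"
proof -
  interpret E: monoidal_category "subunit_category C"
    by (rule assms)
  interpret Endo: monoidal_category Endo
    by (rule monoidal_category_Endo)
  interpret is_functor "subunit_category C" Endo "restriction C"
    by (rule restriction_functor)
  have tensor [simp]: "mono_subunit C (subunit_tensor C s t)"
    if "mono_subunit C s" "mono_subunit C t" for s t
    using E.TObj_in_Obj[of s t] that by simp
  show ?thesis
  proof (unfold_locales, goal_cases unit mult natural assoc unit_left unit_right)
    case unit
    then show ?case
      by (simp add: Endo.in_hom_iff)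
  next
    case (mult s t)
    then show ?case
      by (simp add: Endo.in_hom_iff)
  next
    case (natural x s s' y t t')
    then obtain f g where f: "x = (s, f, s')" "f \<in> Arr C" "Cod C f = Dom C s'" "Dom C f = Dom C s"
      and g: "y = (t, g, t')" "g \<in> Arr C" "Cod C g = Dom C t'" "Dom C g = Dom C t"
      and subunits: "mono_subunit C s" "mono_subunit C s'" "mono_subunit C t" "mono_subunit C t'"
      by (auto simp: subunit_hom_iff)
    show ?case
    \<comment> \<open>Subgoal 5 is the equality of components; the others are typing.\<close>
    proof (rule endo_nat_eqI, goal_cases)
      case (5 A)
      then show ?case
        using f g subunits Assoc_natural_Arr[of "Ident C A" f g] by (simp add: interchange)
    qed (use f g subunits in simp_all)
  next
    case (assoc s t u)
    then show ?case
      by (intro endo_nat_eqI) (simp_all add: comp_functor_assoc pentagon)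
  next
    case (unit_left s)
    show ?case
    proof (rule endo_nat_eqI, goal_cases)
      case (5 A)
      then show ?case
        using unit_left by (simp add: triangle interchange)
    qed (use unit_left in simp_all)
  next
    case (unit_right s)
    show ?case
    proof (rule endo_nat_eqI, goal_cases)
      case (5 A)
      then show ?case
        using unit_right by (simp add: RUnit_TObj)
    qed (use unit_right in simp_all)
  qed
qed

end

theorem theorem4p13:
  fixes C :: "('o, 'a) braided_monoidal_category"
  assumes braided: "braided_monoidal_category C"
    and tensor_monic: "\<And>s t. \<lbrakk>s \<in> Obj (subunit_category C); t \<in> Obj (subunit_category C)\<rbrakk>
          \<Longrightarrow> monic C (s \<boxtimes>\<^bsub>subunit_category C\<^esub> t)"
  shows "\<exists>\<eta> \<mu>. graded_monad (subunit_category C) C (restriction C) \<eta> \<mu>"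
proof -
  interpret braided_monoidal_category C
    by (rule braided)
  have "monoidal_category (subunit_category C)"
    using tensor_monic by (intro monoidal_category_subunit) simp
  then have "lax_monoidal_functor (subunit_category C) (endofunctor_category C) (restriction C)
      restriction_unit restriction_mult"
    by (rule restriction_lax_monoidal_functor)
  then show ?thesis
    using category_axioms unfolding graded_monad_def by blast
qed

end
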